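(* Let $n\ge1$, let $H\in\mathbb{R}^{n\times n}$ be symmetric positive definite, and let $W=\omega(H)$ be a fixed positive spectral weight. Every state $(u,v)\in\Omega_{\rm BB}(H)$ is the consecutive-gradient state obtained after one admissible warm-up step: there exist $x_0,x_1\in\mathbb{R}^n$ and $\alpha\in[b^{-1},a^{-1}]$ with $Hx_0=u$, $Hx_1=v$ and $x_1=x_0-\alpha Hx_0$. Moreover, starting from this state, its subsequent delayed weighted Rayleigh trajectory is exactly the orbit of $T_W$: if $g_0=u$, $g_1=v$, and $(g_k)_{k\ge 0}$ is continued by $g_{k+1}=(I-\alpha_W(g_{k-1})H)g_k$ for $k\ge1$, with zero continuation after termination, then $(g_k,g_{k+1})=T_W^k(u,v)$ for all $k\ge0$.
   Context: The underlying objective is $f(x)=\frac12x^THx$ on $\mathbb{R}^n$ (minimizer translated to the origin), with gradient $g=Hx$. Let $a:=\lambda_{\min}(H)>0$ and $b:=\lambda_{\max}(H)$ be the smallest and largest eigenvalues of $H$. A positive spectral weight is a matrix $W=\omega(H)$ (functional calculus), where $\omega$ is a real function on the spectrum $\sigma(H)$ with $\omega(\lambda)>0$ for every $\lambda\in\sigma(H)$; thus $W$ is symmetric positive definite and $WH=HW$. For $u\in\mathbb{R}^n\setminus\{0\}$ set $\alpha_W(u):=\dfrac{u^TWu}{u^TWHu}\in[b^{-1},a^{-1}]$. The compatible cone is $$\Omega_{\rm BB}(H):=\{(u,v)\in\mathbb{R}^n\times\mathbb{R}^n: v=(I-\alpha H)u\text{ for some }\alpha\in[b^{-1},a^{-1}]\}.$$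 Its only element with $u=0$ is $(0,0)$. Define $T_W:\Omega_{\rm BB}(H)\to\Omega_{\rm BB}(H)$ by $T_W(u,v):=\bigl(v,(I-\alpha_W(u)H)v\bigr)$ if $u\ne 0$, and $T_W(0,0):=(0,0)$. A step is admissible if its stepsize lies in $[b^{-1},a^{-1}]$. Zero continuation after termination means that if $g_j=0$ for some $j$, then $g_k=0$ for all $k\ge j$. *)

theory Defs
  imports "HOL-Analysis.Analysis"
begin

definition spd :: "real^'n^'n \<Rightarrow> bool"
  where "spd H \<longleftrightarrow> transpose H = H \<and> (\<forall>x. x \<noteq> 0 \<longrightarrow> 0 < x \<bullet> (H *v x))"

definition eigenspace :: "real^'n^'n \<Rightarrow> real \<Rightarrow> (real^'n) set"
  where "eigenspace H l = {x. H *v x = l *\<^sub>R x}"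

text \<open>Only real eigenvalues are collected; for the symmetric matrices considered here
  these are all of them.\<close>

definition spectrum :: "real^'n^'n \<Rightarrow> real set"
  where "spectrum H = {l. \<exists>x. x \<noteq> 0 \<and> H *v x = l *\<^sub>R x}"

text \<open>For symmetric matrices the spectrum is finite and nonempty
  (lemmas \<open>finite_spectrum\<close> and \<open>spectrum_nonempty\<close> below), so these are genuine extrema.\<close>

definition lambda_min :: "real^'n^'n \<Rightarrow> real"
  where "lambda_min H = Min (spectrum H)"

definition lambda_max :: "real^'n^'n \<Rightarrow> real"
  where "lambda_max H = Max (spectrum H)"

text \<open>Functional calculus of a symmetric matrix:
  \<open>\<omega>(H)\<close> is the sum of \<open>\<omega>(\<lambda>) P\<^sub>\<lambda>\<close> over the spectrum, with \<open>P\<^sub>\<lambda>\<close> the orthogonal projection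
  onto the eigenspace of \<open>\<lambda>\<close>.  On a linear subspace, the nearest-point map
  is that orthogonal projection.\<close>

definition spectral_projection :: "real^'n^'n \<Rightarrow> real \<Rightarrow> real^'n^'n"
  where "spectral_projection H l = matrix (closest_point (eigenspace H l))"

definition matrix_fun :: "(real \<Rightarrow> real) \<Rightarrow> real^'n^'n \<Rightarrow> real^'n^'n"
  where "matrix_fun \<omega> H = (\<Sum>l\<in>spectrum H. \<omega> l *\<^sub>R spectral_projection H l)"

definition admissible_steps :: "real^'n^'n \<Rightarrow> real set"
  where "admissible_steps H = {inverse (lambda_max H) .. inverse (lambda_min H)}"

definition rayleigh_step :: "real^'n^'n \<Rightarrow> real^'n^'n \<Rightarrow> real^'n \<Rightarrow> real"
  where "rayleigh_step H W u = (u \<bullet> (W *v u)) / (u \<bullet> ((W ** H) *v u))"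

definition Omega_BB :: "real^'n^'n \<Rightarrow> ((real^'n) \<times> (real^'n)) set"
  where "Omega_BB H = {(u, v). \<exists>\<alpha>\<in>admissible_steps H. v = (mat 1 - \<alpha> *\<^sub>R H) *v u}"

text \<open>A total function on pairs; it is used only on \<open>Omega_BB H\<close>, which it maps into itself
  (lemma \<open>T_map_Omega_BB\<close> below) and where \<open>u = 0\<close> forces \<open>v = 0\<close>.\<close>

definition T_map :: "real^'n^'n \<Rightarrow> real^'n^'n \<Rightarrow> (real^'n) \<times> (real^'n) \<Rightarrow> (real^'n) \<times> (real^'n)"
  where "T_map H W = (\<lambda>(u, v).
    if u \<noteq> 0 then (v, (mat 1 - rayleigh_step H W u *\<^sub>R H) *v v) else (0, 0))"

text \<open>The step \<open>rayleigh_step H W (g (k - 1))\<close> is defined only while \<open>g (k - 1) \<noteq> 0\<close>; afterwards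
  the second conjunct, zero continuation, determines the sequence.\<close>

definition delayed_trajectory :: "real^'n^'n \<Rightarrow> real^'n^'n \<Rightarrow> (nat \<Rightarrow> real^'n) \<Rightarrow> bool"
  where "delayed_trajectory H W g \<longleftrightarrow>
    (\<forall>k\<ge>1. g (k - 1) \<noteq> 0 \<longrightarrow> g (k + 1) = (mat 1 - rayleigh_step H W (g (k - 1)) *\<^sub>R H) *v g k) \<and>
    (\<forall>j. g j = 0 \<longrightarrow> (\<forall>k\<ge>j. g k = 0))"


subsection \<open>Well-definedness of the notions above\<close>

lemma symmetric_inner:
  fixes H :: "real^'n^'n"
  assumes "transpose H = H"
  shows "(H *v x) \<bullet> y = x \<bullet> (H *v y)"
  by (metis assms dot_lmul_matrix inner_commute vector_transpose_matrix)

lemma subspace_eigenspace: "subspace (eigenspace H l)"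
  unfolding subspace_def eigenspace_def
  by (auto simp: matrix_vector_right_distrib matrix_vector_mult_scaleR scaleR_right_distrib
      scaleR_left_commute mult.commute)

lemma eigenspace_orthogonal:
  fixes H :: "real^'n^'n"
  assumes "transpose H = H" "x \<in> eigenspace H l" "y \<in> eigenspace H m" "l \<noteq> m"
  shows "x \<bullet> y = 0"
proof -
  have "l * (x \<bullet> y) = m * (x \<bullet> y)"
    using symmetric_inner[OF assms(1), of x y] assms(2,3) by (simp add: eigenspace_def)
  then show ?thesis using assms(4) by simp
qed

lemma finite_spectrum:
  fixes H :: "real^'n^'n"
  assumes sym: "transpose H = H"
  shows "finite (spectrum H)"
proof -
  obtain e where e: "\<And>l. l \<in> spectrum H \<Longrightarrow> e l \<noteq> 0 \<and> H *v e l = l *\<^sub>R e l"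
    using bchoice[of "spectrum H" "\<lambda>l x. x \<noteq> 0 \<and> H *v x = l *\<^sub>R x"] by (auto simp: spectrum_def)
  have orth: "e l \<bullet> e m = 0" if "l \<in> spectrum H" "m \<in> spectrum H" "l \<noteq> m" for l m
    using eigenspace_orthogonal[OF sym, of "e l" l "e m" m] e that by (auto simp: eigenspace_def)
  have "inj_on e (spectrum H)"
    using orth e by (metis inj_onI inner_eq_zero_iff)
  moreover have "pairwise orthogonal (e ` spectrum H)"
    by (auto simp: pairwise_def orthogonal_def) (metis orth)
  then have "finite (e ` spectrum H)" by (rule pairwise_orthogonal_imp_finite)
  ultimately show ?thesis by (simp add: finite_image_iff)
qed

lemma ex_eigenvector_in_subspace:
  fixes H :: "real^'n^'n"
  assumes sym: "transpose H = H" and S: "subspace S" "S \<noteq> {0}"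
    and inv: "\<And>x. x \<in> S \<Longrightarrow> H *v x \<in> S"
  obtains m \<mu> where "m \<in> S" "m \<noteq> 0" "H *v m = \<mu> *\<^sub>R m"
proof -
  define K where "K = sphere 0 1 \<inter> S"
  have "compact K" unfolding K_def
    by (intro compact_Int_closed closed_subspace S(1)) simp
  moreover obtain z where z: "z \<in> S" "z \<noteq> 0"
    using S subspace_0 by blast
  have "K \<noteq> {}"
  proof -
    have "(1 / norm z) *\<^sub>R z \<in> K" using z S(1) by (simp add: K_def subspace_scale)
    then show ?thesis by blast
  qed
  moreover have "continuous_on K (\<lambda>x. x \<bullet> (H *v x))"
    by (intro continuous_intros linear_continuous_on) simp
  ultimately obtain m where m: "m \<in> K" "\<And>y. y \<in> K \<Longrightarrow> y \<bullet> (H *v y) \<le> m \<bullet> (H *v m)"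
    using continuous_attains_sup[of K "\<lambda>x. x \<bullet> (H *v x)"] by blast
  define \<mu> where "\<mu> = m \<bullet> (H *v m)"
  have mm: "m \<bullet> m = 1" "m \<in> S" using m(1) by (auto simp: K_def norm_eq_1)
  have bound: "y \<bullet> (H *v y) \<le> \<mu> * (y \<bullet> y)" if "y \<in> S" for y
  proof (cases "y = 0")
    case False
    have "(1 / norm y) *\<^sub>R y \<in> K" using that False S(1) by (simp add: K_def subspace_scale)
    from m(2)[OF this] have "(y \<bullet> (H *v y)) / (norm y)\<^sup>2 \<le> \<mu>"
      by (simp add: matrix_vector_mult_scaleR \<mu>_def power2_eq_square)
    then show ?thesis using False by (simp add: divide_le_eq power2_norm_eq_inner)
  qed simp
  define w where "w = H *v m - \<mu> *\<^sub>R m"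
  have wS: "w \<in> S" using mm inv S(1) by (simp add: w_def subspace_diff subspace_scale)
  have wm: "w \<bullet> m = 0" using mm by (simp add: w_def inner_diff_left \<mu>_def inner_commute[of "H *v m"])
  have wH: "w \<bullet> (H *v m) = w \<bullet> w"
  proof -
    have "H *v m = w + \<mu> *\<^sub>R m" by (simp add: w_def)
    then show ?thesis using wm by (simp add: inner_add_right)
  qed
  define C where "C = \<mu> * (w \<bullet> w) - w \<bullet> (H *v w)"
  have C0: "C \<ge> 0" using bound[OF wS] by (simp add: C_def)
  have quad: "2 * t * (w \<bullet> w) \<le> t\<^sup>2 * C" for t
  proof -
    have "m + t *\<^sub>R w \<in> S" using mm wS S(1) by (simp add: subspace_add subspace_scale)
    from bound[OF this] show ?thesis
      using mm wm wH symmetric_inner[OF sym, of m w]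
      by (simp add: matrix_vector_right_distrib matrix_vector_mult_scaleR inner_add_left
          inner_add_right \<mu>_def[symmetric] C_def inner_commute algebra_simps power2_eq_square)
  qed
  have "w \<bullet> w = 0"
  proof (rule ccontr)
    assume "w \<bullet> w \<noteq> 0"
    then have p: "w \<bullet> w > 0" using inner_ge_zero[of w] by linarith
    define t where "t = (w \<bullet> w) / (C + 1)"
    have t: "t > 0" using p C0 by (simp add: t_def)
    have "2 * (w \<bullet> w) \<le> t * C"
      using quad[of t] t by (simp add: power2_eq_square mult.assoc mult.left_commute)
    also have "\<dots> \<le> w \<bullet> w" using C0 p by (simp add: t_def field_simps)
    finally show False using p by simp
  qed
  then have "H *v m = \<mu> *\<^sub>R m" by (simp add: w_def)
  moreover have "m \<noteq> 0" using mm by auto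
  ultimately show ?thesis using that mm by blast
qed

lemma spectrum_nonempty:
  fixes H :: "real^'n^'n"
  assumes "transpose H = H"
  shows "spectrum H \<noteq> {}"
proof -
  obtain x :: "real^'n" where "x \<noteq> 0" using zero_neq_one by metis
  then have "(UNIV :: (real^'n) set) \<noteq> {0}" by auto
  from ex_eigenvector_in_subspace[OF assms subspace_UNIV this]
  obtain m \<mu> where "m \<noteq> 0" "H *v m = \<mu> *\<^sub>R m" by blast
  then show ?thesis by (auto simp: spectrum_def)
qed

lemma span_eigenspaces:
  fixes H :: "real^'n^'n"
  assumes sym: "transpose H = H"
  shows "span (\<Union>l\<in>spectrum H. eigenspace H l) = UNIV"
proof (rule ccontr)
  define E where "E = (\<Union>l\<in>spectrum H. eigenspace H l)"
  assume "span (\<Union>l\<in>spectrum H. eigenspace H l) \<noteq> UNIV"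
  then obtain a where a: "a \<noteq> 0" "\<forall>x\<in>span E. a \<bullet> x = 0"
    using span_not_UNIV_orthogonal unfolding E_def by blast
  define S where "S = {y. \<forall>x\<in>E. y \<bullet> x = 0}"
  have aS: "a \<in> S" using a span_base by (auto simp: S_def)
  have "subspace S" by (auto simp: S_def subspace_def inner_add_left)
  moreover have "S \<noteq> {0}" using a(1) aS by blast
  moreover have "H *v y \<in> S" if "y \<in> S" for y
    using that symmetric_inner[OF sym] by (auto simp: S_def E_def eigenspace_def)
  ultimately obtain m \<mu> where m: "m \<in> S" "m \<noteq> 0" "H *v m = \<mu> *\<^sub>R m"
    using ex_eigenvector_in_subspace[OF sym] by metis
  then have "m \<in> E" by (auto simp: E_def spectrum_def eigenspace_def)
  then show False using m by (auto simp: S_def)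
qed

lemma spectral_decomposition:
  fixes H :: "real^'n^'n"
  assumes sym: "transpose H = H"
  obtains p where "\<And>l. l \<in> spectrum H \<Longrightarrow> p l \<in> eigenspace H l" "x = (\<Sum>l\<in>spectrum H. p l)"
proof -
  define D where "D = {x. \<exists>p. (\<forall>l\<in>spectrum H. p l \<in> eigenspace H l) \<and> x = (\<Sum>l\<in>spectrum H. p l)}"
  have "subspace D"
    unfolding subspace_def
  proof (intro conjI ballI allI)
    show "0 \<in> D" unfolding D_def
      by (auto intro!: exI[of _ "\<lambda>_. 0"] simp: subspace_0[OF subspace_eigenspace])
  next
    fix x y assume "x \<in> D" "y \<in> D"
    then obtain p q where "\<forall>l\<in>spectrum H. p l \<in> eigenspace H l" "x = (\<Sum>l\<in>spectrum H. p l)"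
      "\<forall>l\<in>spectrum H. q l \<in> eigenspace H l" "y = (\<Sum>l\<in>spectrum H. q l)" unfolding D_def by blast
    then show "x + y \<in> D" unfolding D_def
      by (auto intro!: exI[of _ "\<lambda>l. p l + q l"] subspace_add[OF subspace_eigenspace]
          simp: sum.distrib)
  next
    fix c :: real and x assume "x \<in> D"
    then obtain p where "\<forall>l\<in>spectrum H. p l \<in> eigenspace H l" "x = (\<Sum>l\<in>spectrum H. p l)"
      unfolding D_def by blast
    then show "c *\<^sub>R x \<in> D" unfolding D_def
      by (auto intro!: exI[of _ "\<lambda>l. c *\<^sub>R p l"] subspace_scale[OF subspace_eigenspace]
          simp: scaleR_sum_right)
  qed
  moreover have "(\<Union>l\<in>spectrum H. eigenspace H l) \<subseteq> D"
  proof
    fix x assume "x \<in> (\<Union>l\<in>spectrum H. eigenspace H l)"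
    then obtain l where l: "l \<in> spectrum H" "x \<in> eigenspace H l" by blast
    then have "x = (\<Sum>k\<in>spectrum H. if k = l then x else 0)"
      using finite_spectrum[OF sym] by simp
    then show "x \<in> D" unfolding D_def mem_Collect_eq
      using l by (intro exI[of _ "\<lambda>k. if k = l then x else 0"])
        (auto simp: subspace_0[OF subspace_eigenspace])
  qed
  ultimately have "span (\<Union>l\<in>spectrum H. eigenspace H l) \<subseteq> D" by (rule span_minimal[rotated])
  then have "x \<in> D" using span_eigenspaces[OF sym] by auto
  then show ?thesis using that unfolding D_def by blast
qed

lemma closest_point_subspace:
  fixes x :: "'a::euclidean_space"
  assumes "subspace S" "p \<in> S" "\<And>w. w \<in> S \<Longrightarrow> (x - p) \<bullet> w = 0"
  shows "closest_point S x = p"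
proof -
  have "dist x p \<le> dist x z" if "z \<in> S" for z
  proof -
    have "(x - p) \<bullet> (p - z) = 0" using assms that by (simp add: subspace_diff)
    then have "(norm (x - p + (p - z)))\<^sup>2 = (norm (x - p))\<^sup>2 + (norm (p - z))\<^sup>2"
      by (intro norm_add_Pythagorean) (simp add: orthogonal_def)
    then have "(norm (x - p))\<^sup>2 \<le> (norm (x - z))\<^sup>2" by simp
    then show ?thesis by (simp add: dist_norm)
  qed
  then show ?thesis
    using assms closed_subspace subspace_imp_convex closest_point_unique[of S p x] by metis
qed

lemma closest_point_eigenspace:
  fixes H :: "real^'n^'n"
  assumes sym: "transpose H = H" and p: "\<And>l. l \<in> spectrum H \<Longrightarrow> p l \<in> eigenspace H l"
    and l: "l \<in> spectrum H"
  shows "closest_point (eigenspace H l) (\<Sum>k\<in>spectrum H. p k) = p l"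
proof (rule closest_point_subspace[OF subspace_eigenspace p[OF l]])
  fix w assume w: "w \<in> eigenspace H l"
  have "(\<Sum>k\<in>spectrum H. p k) - p l = (\<Sum>k\<in>spectrum H - {l}. p k)"
    using l finite_spectrum[OF sym] by (simp add: sum_diff1)
  also have "\<dots> \<bullet> w = 0"
    unfolding inner_sum_left using eigenspace_orthogonal[OF sym p w] by (intro sum.neutral) auto
  finally show "((\<Sum>k\<in>spectrum H. p k) - p l) \<bullet> w = 0" .
qed

lemma linear_closest_point_eigenspace:
  fixes H :: "real^'n^'n"
  assumes sym: "transpose H = H" and l: "l \<in> spectrum H"
  shows "linear (closest_point (eigenspace H l))"
proof (rule linearI)
  fix x y
  obtain p where p: "\<And>l. l \<in> spectrum H \<Longrightarrow> p l \<in> eigenspace H l" "x = (\<Sum>l\<in>spectrum H. p l)"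
    by (rule spectral_decomposition[OF sym, where x = x]) blast
  obtain q where q: "\<And>l. l \<in> spectrum H \<Longrightarrow> q l \<in> eigenspace H l" "y = (\<Sum>l\<in>spectrum H. q l)"
    by (rule spectral_decomposition[OF sym, where x = y]) blast
  have pq: "\<And>l. l \<in> spectrum H \<Longrightarrow> p l + q l \<in> eigenspace H l"
    using p q subspace_add[OF subspace_eigenspace] by blast
  show "closest_point (eigenspace H l) (x + y)
      = closest_point (eigenspace H l) x + closest_point (eigenspace H l) y"
    using closest_point_eigenspace[OF sym p(1) l] closest_point_eigenspace[OF sym q(1) l]
      closest_point_eigenspace[OF sym pq l] p(2) q(2) by (simp add: sum.distrib)
next
  fix c :: real and x
  obtain p where p: "\<And>l. l \<in> spectrum H \<Longrightarrow> p l \<in> eigenspace H l" "x = (\<Sum>l\<in>spectrum H. p l)"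
    by (rule spectral_decomposition[OF sym, where x = x]) blast
  have cp: "\<And>l. l \<in> spectrum H \<Longrightarrow> c *\<^sub>R p l \<in> eigenspace H l"
    using p subspace_scale[OF subspace_eigenspace] by blast
  show "closest_point (eigenspace H l) (c *\<^sub>R x) = c *\<^sub>R closest_point (eigenspace H l) x"
    using closest_point_eigenspace[OF sym p(1) l] closest_point_eigenspace[OF sym cp l] p(2)
    by (simp add: scaleR_sum_right)
qed

lemma matrix_fun_decomposition:
  fixes H :: "real^'n^'n"
  assumes sym: "transpose H = H" and p: "\<And>l. l \<in> spectrum H \<Longrightarrow> p l \<in> eigenspace H l"
  shows "matrix_fun \<omega> H *v (\<Sum>l\<in>spectrum H. p l) = (\<Sum>l\<in>spectrum H. \<omega> l *\<^sub>R p l)"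
proof -
  have "(\<Sum>l\<in>A. \<omega> l *\<^sub>R spectral_projection H l) *v x
      = (\<Sum>l\<in>A. \<omega> l *\<^sub>R (spectral_projection H l *v x))" if "finite A" for A x
    using that
    by (induction A)
      (auto simp: matrix_vector_mult_add_rdistrib scaleR_matrix_vector_assoc)
  then have "matrix_fun \<omega> H *v (\<Sum>l\<in>spectrum H. p l)
      = (\<Sum>l\<in>spectrum H. \<omega> l *\<^sub>R (spectral_projection H l *v (\<Sum>l\<in>spectrum H. p l)))"
    unfolding matrix_fun_def using finite_spectrum[OF sym] by blast
  also have "\<dots> = (\<Sum>l\<in>spectrum H. \<omega> l *\<^sub>R p l)"
    using linear_closest_point_eigenspace[OF sym] closest_point_eigenspace[OF sym p]
    by (intro sum.cong) (auto simp: spectral_projection_def matrix_works)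
  finally show ?thesis .
qed

lemma rayleigh_step_admissible:
  fixes H :: "real^'n^'n"
  assumes H: "spd H" and \<omega>: "\<And>l. l \<in> spectrum H \<Longrightarrow> 0 < \<omega> l" and u: "u \<noteq> 0"
  shows "rayleigh_step H (matrix_fun \<omega> H) u \<in> admissible_steps H"
proof -
  let ?S = "spectrum H" and ?W = "matrix_fun \<omega> H"
  have sym: "transpose H = H" using H by (simp add: spd_def)
  note fin = finite_spectrum[OF sym]
  obtain p where p: "\<And>l. l \<in> ?S \<Longrightarrow> p l \<in> eigenspace H l" and up: "u = (\<Sum>l\<in>?S. p l)"
    by (rule spectral_decomposition[OF sym, where x = u]) blast
  have Hp: "H *v p l = l *\<^sub>R p l" if "l \<in> ?S" for l using p[OF that] by (simp add: eigenspace_def)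
  have Hu: "H *v u = (\<Sum>l\<in>?S. l *\<^sub>R p l)"
    unfolding up by (simp add: linear_sum[OF matrix_vector_mul_linear] o_def Hp cong: sum.cong)
  have Wu: "?W *v u = (\<Sum>l\<in>?S. \<omega> l *\<^sub>R p l)"
    using matrix_fun_decomposition[OF sym p] up by simp
  have "\<And>l. l \<in> ?S \<Longrightarrow> l *\<^sub>R p l \<in> eigenspace H l"
    using p subspace_scale[OF subspace_eigenspace] by blast
  from matrix_fun_decomposition[OF sym this]
  have WHu: "(?W ** H) *v u = (\<Sum>l\<in>?S. (\<omega> l * l) *\<^sub>R p l)"
    by (simp add: matrix_vector_mul_assoc[symmetric] Hu)
  have ip: "u \<bullet> (\<Sum>l\<in>?S. c l *\<^sub>R p l) = (\<Sum>l\<in>?S. c l * (p l \<bullet> p l))" for c :: "real \<Rightarrow> real"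
    unfolding inner_sum_right
  proof (rule sum.cong[OF refl])
    fix l assume l: "l \<in> ?S"
    have "u \<bullet> p l = (\<Sum>k\<in>?S. if k = l then p l \<bullet> p l else 0)"
      unfolding up inner_sum_left using eigenspace_orthogonal[OF sym p p] l
      by (intro sum.cong) auto
    then show "u \<bullet> c l *\<^sub>R p l = c l * (p l \<bullet> p l)" using l fin by simp
  qed
  define N where "N = (\<Sum>l\<in>?S. \<omega> l * (p l \<bullet> p l))"
  define M where "M = (\<Sum>l\<in>?S. \<omega> l * l * (p l \<bullet> p l))"
  have r: "rayleigh_step H ?W u = N / M"
    unfolding rayleigh_step_def Wu WHu ip N_def M_def ..
  have pos: "0 < l" if l: "l \<in> ?S" for l
  proof -
    obtain x where x: "x \<noteq> 0" "H *v x = l *\<^sub>R x" using l by (auto simp: spectrum_def)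
    then have "0 < l * (x \<bullet> x)" using H by (auto simp: spd_def dest!: spec[of _ x])
    then show ?thesis using inner_ge_zero[of x] by (simp add: zero_less_mult_iff not_less[symmetric])
  qed
  have mn: "lambda_min H \<in> ?S" and mx: "lambda_max H \<in> ?S"
    using spectrum_nonempty[OF sym] fin by (simp_all add: lambda_min_def lambda_max_def)
  have le: "lambda_min H \<le> l" "l \<le> lambda_max H" if "l \<in> ?S" for l
    using that fin by (simp_all add: lambda_min_def lambda_max_def)
  obtain l0 where l0: "l0 \<in> ?S" "p l0 \<noteq> 0" using u up by (metis sum.neutral)
  have N0: "0 < N" unfolding N_def
    using l0 fin \<omega> by (intro sum_pos2[of _ l0]) (auto simp: less_imp_le)
  have lo: "lambda_min H * N \<le> M" unfolding N_def M_def sum_distrib_left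
    using le \<omega> by (intro sum_mono) (auto intro!: mult_right_mono simp: mult.assoc[symmetric] mult.commute less_imp_le)
  have hi: "M \<le> lambda_max H * N" unfolding N_def M_def sum_distrib_left
    using le \<omega> by (intro sum_mono) (auto intro!: mult_right_mono simp: mult.assoc[symmetric] mult.commute less_imp_le)
  have M0: "0 < M" using lo N0 pos[OF mn] by (meson less_le_trans mult_pos_pos)
  show ?thesis unfolding r admissible_steps_def
    using lo hi M0 pos[OF mn] pos[OF mx] by (simp add: field_simps)
qed

lemma T_map_Omega_BB:
  fixes H :: "real^'n^'n"
  assumes "spd H" "\<And>l. l \<in> spectrum H \<Longrightarrow> 0 < \<omega> l" "s \<in> Omega_BB H"
  shows "T_map H (matrix_fun \<omega> H) s \<in> Omega_BB H"
  using rayleigh_step_admissible[of H \<omega>] assms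
  by (auto simp: T_map_def Omega_BB_def split: prod.splits)

end

theory Submission
  imports Defs
begin

text \<open>
  A positive definite \<open>H\<close> is invertible, so every vector is a gradient: with \<open>u = H x\<^sub>0\<close>, taking
  one step \<open>x\<^sub>1 = x\<^sub>0 - \<alpha> H x\<^sub>0\<close> of the length \<open>\<alpha>\<close> that witnesses membership of \<open>(u, v)\<close> in the
  compatible cone produces the gradient \<open>H x\<^sub>1 = (I - \<alpha> H) u = v\<close>.

  The orbit identity is the recurrence read off pair by pair.  Where \<open>g\<^sub>k \<noteq> 0\<close>, the map and the
  trajectory apply the same formula.  Where \<open>g\<^sub>k = 0\<close>, zero continuation gives
  \<open>g\<^bsub>k+1\<^esub> = g\<^bsub>k+2\<^esub> = 0\<close>, which matches the fixed point \<open>(0, 0)\<close> of the map.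
\<close>

text \<open>In finite dimension it is enough that \<open>H\<close> has trivial kernel, and \<open>H x = 0\<close> forces
  \<open>x \<bullet> H x = 0\<close>, hence \<open>x = 0\<close>.\<close>

lemma spd_surj:
  fixes H :: "real^'n^'n"
  assumes "spd H"
  shows "surj ((*v) H)"
proof (rule linear_inj_imp_surj)
  show "linear ((*v) H)" by (rule matrix_vector_mul_linear)
  show "inj ((*v) H)"
    unfolding linear_injective_0[OF matrix_vector_mul_linear]
  proof (intro allI impI)
    fix x assume "H *v x = 0"
    then show "x = 0" using assms by (metis spd_def inner_zero_right less_irrefl)
  qed
qed

lemma mat_1_minus_scaleR_mult:
  fixes H :: "real^'n^'n"
  shows "(mat 1 - \<alpha> *\<^sub>R H) *v x = x - \<alpha> *\<^sub>R (H *v x)"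
  by (simp add: matrix_vector_mult_diff_rdistrib scaleR_matrix_vector_assoc)

lemma Omega_BB_warm_up:
  fixes H :: "real^'n^'n"
  assumes "spd H" "(u, v) \<in> Omega_BB H"
  shows "\<exists>x0 x1. \<exists>\<alpha>\<in>admissible_steps H.
    H *v x0 = u \<and> H *v x1 = v \<and> x1 = x0 - \<alpha> *\<^sub>R (H *v x0)"
proof -
  obtain \<alpha> where \<alpha>: "\<alpha> \<in> admissible_steps H" and v: "v = u - \<alpha> *\<^sub>R (H *v u)"
    using assms(2) by (auto simp: Omega_BB_def mat_1_minus_scaleR_mult)
  obtain x0 where x0: "H *v x0 = u"
    using spd_surj[OF assms(1)] by (metis surjD)
  have "H *v (x0 - \<alpha> *\<^sub>R (H *v x0)) = v"
    by (simp add: v x0 matrix_vector_mult_diff_distrib matrix_vector_mult_scaleR)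
  then show ?thesis using \<alpha> x0 by blast
qed

text \<open>One step of the orbit identity; the case split is on termination at index \<open>k\<close>.\<close>

lemma T_map_delayed_trajectory:
  assumes "delayed_trajectory H W g"
  shows "T_map H W (g k, g (Suc k)) = (g (Suc k), g (Suc (Suc k)))"
proof (cases "g k = 0")
  case True
  then have "g j = 0" if "j \<ge> k" for j
    using assms that unfolding delayed_trajectory_def by blast
  then show ?thesis by (simp add: T_map_def)
next
  case False
  \<comment> \<open>The recurrence at index \<open>k + 1\<close> uses the stepsize delayed to \<open>g k\<close>.\<close>
  have "g (Suc k - 1) \<noteq> 0 \<longrightarrow>
      g (Suc k + 1) = (mat 1 - rayleigh_step H W (g (Suc k - 1)) *\<^sub>R H) *v g (Suc k)"
    using assms unfolding delayed_trajectory_def by (metis le_add1 plus_1_eq_Suc)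
  then show ?thesis using False by (simp add: T_map_def)
qed

lemma delayed_trajectory_orbit:
  assumes "delayed_trajectory H W g"
  shows "(g k, g (Suc k)) = (T_map H W ^^ k) (g 0, g 1)"
proof (induction k)
  case (Suc k)
  then show ?case using T_map_delayed_trajectory[OF assms, of k] by simp
qed simp

theorem lemma3p3:
  fixes H W :: "real^'n^'n" and \<omega> :: "real \<Rightarrow> real" and u v :: "real^'n"
  assumes "spd H"
    and "\<forall>l\<in>spectrum H. 0 < \<omega> l"
    and "W = matrix_fun \<omega> H"
    and "(u, v) \<in> Omega_BB H"
  shows "(\<exists>x0 x1. \<exists>\<alpha>\<in>admissible_steps H.
        H *v x0 = u \<and> H *v x1 = v \<and> x1 = x0 - \<alpha> *\<^sub>R (H *v x0)) \<and>
    (\<forall>g. g 0 = u \<and> g 1 = v \<and> delayed_trajectory H W g \<longrightarrow>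
        (\<forall>k. (g k, g (k + 1)) = (T_map H W ^^ k) (u, v)))"
  using Omega_BB_warm_up[OF assms(1,4)] delayed_trajectory_orbit[of H W]
  by (metis Suc_eq_plus1)

end
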